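(* Let $A$ be a finite set of positive integers with $|A|\ge2$, smallest element $a_1$, largest element $\alpha$ and second largest element $\alpha'$, and let $\beta=\min(\alpha,a_1+\alpha')$. Then $\operatorname{preper}(A)+\operatorname{per}(A)\leq(\beta+1)2^{\alpha-|A|}$.
   Context: $w^A:\mathbb{Z}\to\{0,1\}$ is defined by $w^A(n)=1$ for $n<0$ and $w^A(n)=1-\min\{w^A(n-x):x\in A\}$ for $n\ge0$. $\operatorname{per}(A)$ is the least $p\geq1$ such that $w^A(n)=w^A(n+p)$ for all sufficiently large $n$, and $\operatorname{preper}(A)$ is the least $N\ge0$ such that $w^A(n)=w^A(n+\operatorname{per}(A))$ for all $n\ge N$. *)

theory Defs
  imports Complex_Main
begin

text \<open>
  The guard \<open>0 < x\<close> only makes the recursion terminate for arbitrary \<open>A\<close>; for sets of positive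
  integers it is vacuous, see \<open>w_nonneg\<close> below.
\<close>

function w :: "nat set \<Rightarrow> int \<Rightarrow> nat" where
  "w A n = (if n < 0 then 1 else 1 - Min ((\<lambda>x. w A (n - int x)) ` {x \<in> A. 0 < x}))"
  by auto
termination
  by (relation "measure (\<lambda>(A, n). nat (n + 1))") auto

declare w.simps [simp del]

lemma w_neg: "n < 0 \<Longrightarrow> w A n = 1"
  by (simp add: w.simps)

lemma w_nonneg:
  assumes "\<forall>x\<in>A. 0 < x" and "n \<ge> 0"
  shows "w A n = 1 - Min ((\<lambda>x. w A (n - int x)) ` A)"
proof -
  have "{x \<in> A. 0 < x} = A"
    using assms(1) by auto
  then show ?thesis
    using assms(2) by (subst w.simps) simp
qed

text \<open>Truncated subtraction on \<open>nat\<close> is harmless in the definition of \<open>w\<close>: all values lie in \<open>{0, 1}\<close>.\<close>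

lemma w_range:
  assumes "finite A" and "A \<noteq> {}" and "\<forall>x\<in>A. 0 < x"
  shows "w A n \<in> {0, 1}" and "n \<ge> 0 \<Longrightarrow> Min ((\<lambda>x. w A (n - int x)) ` A) \<in> {0, 1}"
proof -
  have range: "w A m \<in> {0, 1}" for m
    by (subst w.simps) auto
  then show "w A n \<in> {0, 1}" .
  have "Min ((\<lambda>x. w A (n - int x)) ` A) \<in> (\<lambda>x. w A (n - int x)) ` A"
    using assms by (intro Min_in) auto
  then show "Min ((\<lambda>x. w A (n - int x)) ` A) \<in> {0, 1}"
    using range by (metis (no_types, lifting) imageE)
qed

definition per :: "nat set \<Rightarrow> nat" where
  "per A = (LEAST p. 1 \<le> p \<and> (\<forall>\<^sub>F n in at_top. w A n = w A (n + int p)))"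

definition preper :: "nat set \<Rightarrow> nat" where
  "preper A = (LEAST N. \<forall>n \<ge> int N. w A n = w A (n + int (per A)))"

end

theory Submission
  imports Defs
begin

text \<open>
  Every window of \<open>\<beta> + 1\<close> consecutive nonnegative positions contains a zero of \<open>w A\<close>, and a zero at
  \<open>m\<close> forces ones at \<open>m + x\<close> for \<open>x \<in> A\<close>. Record for each \<open>n \<ge> 0\<close> the distance \<open>i \<le> \<beta>\<close> to the next
  zero and the set of \<open>x \<in> {1..\<alpha>} - A\<close> such that \<open>n + i + x\<close> is a zero. There are at most
  \<open>(\<beta> + 1) * 2 ^ (\<alpha> - card A)\<close> such records. Each of them determines the values of \<open>w A\<close> on
  \<open>{n..n + i + \<alpha>}\<close> and hence, by the recursion, everywhere to the right of \<open>n\<close>. So the pigeonhole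
  principle yields two positions at which the sequence repeats.
\<close>

locale subtraction_set =
  fixes A :: "nat set"
  assumes finite_A: "finite A" and pos_A: "\<forall>x\<in>A. 0 < x" and nonempty_A: "A \<noteq> {}"
begin

lemma w_eq_1_iff: "w A n = 1 \<longleftrightarrow> w A n \<noteq> 0"
  using w_range(1)[OF finite_A nonempty_A pos_A, of n] by auto

lemma w_eq_0_iff: "w A n = 0 \<longleftrightarrow> n \<ge> 0 \<and> (\<forall>x\<in>A. w A (n - int x) \<noteq> 0)"
proof (cases "n \<ge> 0")
  case True
  let ?V = "(\<lambda>x. w A (n - int x)) ` A"
  have "w A n = 0 \<longleftrightarrow> Min ?V \<ge> 1"
    using w_nonneg[OF pos_A True] by auto
  also have "\<dots> \<longleftrightarrow> (\<forall>v\<in>?V. v \<ge> 1)"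
    using finite_A nonempty_A by (intro Min_ge_iff) auto
  finally show ?thesis
    using True by (auto simp: Suc_le_eq)
next
  case False
  then show ?thesis
    by (simp add: w_neg)
qed

lemma zero_shift: "w A m = 0 \<Longrightarrow> x \<in> A \<Longrightarrow> w A (m + int x) \<noteq> 0"
  using w_eq_0_iff[of "m + int x"] by auto

lemma nonzero_obtains:
  assumes "w A n \<noteq> 0" and "n \<ge> 0"
  obtains x where "x \<in> A" and "w A (n - int x) = 0"
proof -
  have "\<exists>x\<in>A. w A (n - int x) = 0"
    using assms w_eq_0_iff[of n] by simp
  then show thesis
    using that by blast
qed

text \<open>A one at \<open>n + Max A\<close> is caused by a zero at most \<open>Max A\<close> steps
  earlier, which still lies at or after \<open>n\<close>.\<close>

lemma zero_within_Max:
  assumes "n \<ge> 0"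
  shows "\<exists>i\<le>Max A. w A (n + int i) = 0"
proof (cases "w A (n + int (Max A)) = 0")
  case False
  then obtain x where x: "x \<in> A" "w A (n + int (Max A) - int x) = 0"
    using nonzero_obtains[of "n + int (Max A)"] assms by auto
  then have "x \<le> Max A"
    using finite_A by simp
  then show ?thesis
    using x by (intro exI[of _ "Max A - x"]) (simp add: of_nat_diff algebra_simps)
qed auto

text \<open>In a window of ones, a one at offset \<open>j >= b\<close> must come from a zero before
  the window. Every element of \<open>A\<close> except \<open>Max A\<close> is too small to reach
  back that far, so that zero is at \<open>n + j - Max A\<close>.\<close>

lemma zero_within_Min_plus:
  assumes "n \<ge> 0" and "\<And>x. x \<in> A \<Longrightarrow> x \<noteq> Max A \<Longrightarrow> x \<le> b"
  shows "\<exists>i\<le>Min A + b. w A (n + int i) = 0"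
proof (rule ccontr)
  assume "\<not> ?thesis"
  then have ones: "w A (n + int i) \<noteq> 0" if "i \<le> Min A + b" for i
    using that by simp
  have zero: "w A (n + int j - int (Max A)) = 0" if j: "b \<le> j" "j \<le> Min A + b" for j
  proof -
    obtain x where x: "x \<in> A" "w A (n + int j - int x) = 0"
      using nonzero_obtains[OF ones[OF j(2)]] assms(1) by auto
    have "x = Max A"
    proof (rule ccontr)
      assume "x \<noteq> Max A"
      then have "x \<le> j"
        using assms(2)[OF x(1)] j by simp
      then have eq: "n + int j - int x = n + int (j - x)"
        by (simp add: of_nat_diff)
      have "w A (n + int (j - x)) \<noteq> 0"
        using j by (intro ones) simp
      then show False
        using x(2) unfolding eq by contradiction
    qed
    then show ?thesis
      using x by simp
  qed
  \<comment> \<open>The offsets \<open>b\<close> and \<open>Min A + b\<close> yield two zeros at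
    distance \<open>Min A\<close>, which \<open>zero_shift\<close> forbids.\<close>
  have "Min A \<in> A"
    using finite_A nonempty_A by simp
  then show False
    using zero_shift[OF zero[of b], of "Min A"] zero[of "Min A + b"] by (simp add: algebra_simps)
qed

text \<open>At nonnegative positions the recursion only looks back at most \<open>Max A\<close>
  steps, so \<open>Max A\<close> consecutive values fix all later ones.\<close>

lemma repeat_extends:
  assumes "0 \<le> n" "0 \<le> m"
    and init: "\<And>k. k < Max A \<Longrightarrow> w A (n + int k) = w A (m + int k)"
  shows "w A (n + int k) = w A (m + int k)"
proof (induction k rule: less_induct)
  case (less k)
  show ?case
  proof (cases "k < Max A")
    case False
    have "w A (n + int k - int x) = w A (m + int k - int x)" if "x \<in> A" for x
    proof -
      have "x \<le> k" "0 < x"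
        using False that pos_A Max_ge[OF finite_A that] by auto
      then show ?thesis
        using less[of "k - x"] by (simp add: of_nat_diff algebra_simps)
    qed
    then have "w A (n + int k) = 0 \<longleftrightarrow> w A (m + int k) = 0"
      using w_eq_0_iff[of "n + int k"] w_eq_0_iff[of "m + int k"] assms(1,2) by auto
    then show ?thesis
      using w_eq_1_iff by metis
  qed (rule init)
qed

text \<open>The difference \<open>j - i\<close> is a period from \<open>i\<close> on, hence bounds
  \<open>per A\<close>; it remains to see that \<open>per A\<close> is also a period from
  \<open>i\<close> on.\<close>

lemma preper_plus_per_le:
  assumes "i < j"
    and init: "\<And>k. k < Max A \<Longrightarrow> w A (int i + int k) = w A (int j + int k)"
  shows "preper A + per A \<le> j"
proof -
  define q where "q = j - i"
  have "q \<ge> 1"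
    using assms(1) by (simp add: q_def)
  have q: "w A n = w A (n + int q)" if "n \<ge> int i" for n
    using repeat_extends[OF _ _ init, of "nat (n - int i)"] that assms(1)
    by (simp add: q_def of_nat_diff algebra_simps)
  have multiples: "w A n = w A (n + int (k * q))" if "n \<ge> int i" for n k
  proof (induction k)
    case (Suc k)
    have "int i \<le> n + int (k * q)"
      using that by (rule order.trans) simp
    then show ?case
      using Suc q[of "n + int (k * q)"] by (simp add: algebra_simps)
  qed simp
  let ?P = "\<lambda>p. 1 \<le> p \<and> (\<forall>\<^sub>F n in at_top. w A n = w A (n + int p))"
  have Pq: "?P q"
    using \<open>q \<ge> 1\<close> q by (auto simp: eventually_at_top_linorder)
  have "per A \<le> q"
    unfolding per_def using Pq by (rule Least_le)
  moreover have "?P (per A)"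
    unfolding per_def using Pq by (rule LeastI)
  then obtain M where M: "\<And>n. n \<ge> M \<Longrightarrow> w A n = w A (n + int (per A))"
    by (auto simp: eventually_at_top_linorder)
  have "w A n = w A (n + int (per A))" if n: "n \<ge> int i" for n
  proof -
    \<comment> \<open>Shifting by \<open>k * q\<close> changes neither \<open>w A n\<close> nor
      \<open>w A (n + int (per A))\<close>, and takes both beyond \<open>M\<close>, where
      \<open>per A\<close> is known to be a period.\<close>
    define k where "k = nat (M - n)"
    have "int k \<le> int (k * q)"
      using \<open>q \<ge> 1\<close> by (subst of_nat_le_iff) simp
    moreover have "M \<le> n + int k"
      by (simp add: k_def)
    ultimately have "n + int (k * q) \<ge> M"
      by linarith
    then show ?thesis
      using multiples[OF n, of k] multiples[of "n + int (per A)" k] M[of "n + int (k * q)"] n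
      by (simp add: algebra_simps)
  qed
  then have "preper A \<le> i"
    unfolding preper_def by (intro Least_le) blast
  ultimately show ?thesis
    using assms(1) by (simp add: q_def)
qed

definition next_zero :: "nat \<Rightarrow> nat" where
  "next_zero n = (LEAST i. w A (int n + int i) = 0)"

text \<open>The set ranges over all of \<open>{1..Max A}\<close>, which makes decoding immediate;
  that it avoids \<open>A\<close> matters for the count.\<close>

definition record_at :: "nat \<Rightarrow> nat \<times> nat set" where
  "record_at n =
    (next_zero n, {x \<in> {1..Max A}. w A (int n + int (next_zero n) + int x) = 0})"

lemma w_next_zero: "w A (int n + int (next_zero n)) = 0"
  unfolding next_zero_def using zero_within_Max[of "int n"] by (auto intro: LeastI)

lemma w_before_next_zero: "k < next_zero n \<Longrightarrow> w A (int n + int k) \<noteq> 0"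
  unfolding next_zero_def by (rule not_less_Least)

lemma next_zero_le: "w A (int n + int i) = 0 \<Longrightarrow> next_zero n \<le> i"
  unfolding next_zero_def by (rule Least_le)

lemma record_at_determines:
  assumes "record_at n = record_at m" and "k < Max A"
  shows "w A (int n + int k) = w A (int m + int k)"
proof -
  define i where "i = next_zero n"
  have i: "next_zero m = i"
    using assms(1) by (simp add: record_at_def i_def)
  have "w A (int n + int k) = 0 \<longleftrightarrow> w A (int m + int k) = 0"
  proof (cases k i rule: linorder_cases)
    case less
    then show ?thesis
      using w_before_next_zero[of k n] w_before_next_zero[of k m] i by (simp add: i_def)
  next
    case equal
    then show ?thesis
      using w_next_zero[of n] w_next_zero[of m] i by (simp add: i_def)
  next
    case greater
    have "{x \<in> {1..Max A}. w A (int n + int i + int x) = 0} =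
        {x \<in> {1..Max A}. w A (int m + int i + int x) = 0}"
      using assms(1) i by (simp add: record_at_def i_def)
    moreover have "k - i \<in> {1..Max A}"
      using greater assms(2) by auto
    ultimately have "w A (int n + int i + int (k - i)) = 0 \<longleftrightarrow> w A (int m + int i + int (k - i)) = 0"
      by blast
    then show ?thesis
      using greater by (simp add: of_nat_diff)
  qed
  then show ?thesis
    using w_eq_1_iff by metis
qed

lemma record_at_in:
  assumes "next_zero n \<le> b"
  shows "record_at n \<in> {..b} \<times> Pow ({1..Max A} - A)"
  using assms by (auto simp: record_at_def dest: zero_shift[OF w_next_zero])

lemma preper_plus_per_bound:
  assumes "\<And>n. next_zero n \<le> b"
  shows "preper A + per A \<le> (b + 1) * 2 ^ (Max A - card A)"
proof -
  define R where "R = {..b} \<times> Pow ({1..Max A} - A)"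
  have "A \<subseteq> {1..Max A}"
    using finite_A pos_A by (auto simp: Suc_le_eq)
  then have card_R: "card R = (b + 1) * 2 ^ (Max A - card A)"
    using finite_A by (simp add: R_def card_cartesian_product card_Pow card_Diff_subset)
  \<comment> \<open>The positions from \<open>0\<close> to \<open>card R\<close> outnumber the
    records by one, so a collision has its larger position at most \<open>card R\<close>.\<close>
  have "record_at ` {..card R} \<subseteq> R"
    unfolding R_def using record_at_in[OF assms] by blast
  moreover have "finite R"
    by (simp add: R_def)
  ultimately have "card (record_at ` {..card R}) < card {..card R}"
    by (simp add: card_mono less_Suc_eq_le)
  then have "\<not> inj_on record_at {..card R}"
    by (rule pigeonhole)
  then obtain i j where ij: "i < j" "j \<le> card R" "record_at i = record_at j"
    unfolding inj_on_def by (metis atMost_iff linorder_neqE_nat)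
  then show ?thesis
    using preper_plus_per_le[OF ij(1) record_at_determines[OF ij(3)]] card_R by simp
qed

end

theorem theorem2p6:
  fixes A :: "nat set" and a\<^sub>1 \<alpha> \<alpha>' \<beta> :: nat
  assumes "finite A" and "\<forall>x\<in>A. 0 < x" and "card A \<ge> 2"
    and "a\<^sub>1 = Min A"
    and "\<alpha> = Max A"
    and "\<alpha>' = Max (A - {\<alpha>})"
    and "\<beta> = min \<alpha> (a\<^sub>1 + \<alpha>')"
  shows "preper A + per A \<le> (\<beta> + 1) * 2 ^ (\<alpha> - card A)"
proof -
  interpret subtraction_set A
    using assms(1-3) by unfold_locales auto
  have "x \<le> \<alpha>'" if "x \<in> A" "x \<noteq> Max A" for x
    using that assms(1,5,6) by simp
  then have "next_zero n \<le> \<beta>" for n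
    using zero_within_Max[of "int n"] zero_within_Min_plus[of "int n" \<alpha>'] next_zero_le[of n] assms(4,5,7)
    by (metis le_trans min.boundedI of_nat_0_le_iff)
  then show ?thesis
    using preper_plus_per_bound assms(5) by simp
qed

end
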